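(* Let $\alpha$ be a dotted composition. The antipode $S$ of $\mathbf{sNSym}$ satisfies $$S(H_{\alpha})=(-1)^{\binom{\mathrm{df}(\alpha)}{2}}\sum_{\beta\preceq\mathrm{rev}(\alpha)}(-1)^{\ell(\beta)}H_{\beta},$$ where $\mathrm{rev}(\alpha)$ is the dotted composition obtained by reversing the order of the entries of $\alpha$.
   Context: Let $\mathbb N=\{1,2,\ldots\}$ and $\dot{\mathbb N}_0=\{\dot0,\dot1,\dot2,\ldots\}$ (dotted copies of the nonnegative integers). A dotted composition is a finite tuple $\alpha=(\alpha_1,\ldots,\alpha_k)$ with entries in $\mathbb N\cup\dot{\mathbb N}_0$; its length is $\ell(\alpha)=k$, its fermionic degree $\mathrm{df}(\alpha)$ is the number of dotted entries, and its degree $|\alpha|$ is $\mathrm{df}(\alpha)$ plus the sum of the numerical values of its entries. For entries not both dotted put $m\oplus n=m+n$ and $m\oplus\dot n=\dot m\oplus n=\dot r$ with $r=m+n$. The partial order $\preceq$ on dotted compositions is the reflexive-transitive closure of the relation: $\beta$ is obtained from $\alpha$ by replacing two consecutive entries $x,y$ of $\alpha$ that are not both dotted by the single entry $x\oplus y$ (then $\alpha\preceq\beta$). $\mathbf{sNSym}$ is the free associative unital $\mathbb Q$-algebra on generators $H_n$ ($n\in\mathbb N$) and $H_{\dot n}=\tilde H_n$ ($n\ge0$), with $H_0=1$ and basis $H_\alpha:=H_{\alpha_1}\cdots H_{\alpha_k}$; $\mathrm{df}$ gives a grading with $\mathrm{df}(H_\alpha)=\mathrm{df}(\alpha)$. The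 space $\mathbf{sNSym}\otimes\mathbf{sNSym}$ is an algebra via $(f_1\otimes g_1)(f_2\otimes g_2)=(-1)^{\mathrm{df}(g_1)\mathrm{df}(f_2)}f_1f_2\otimes g_1g_2$ for $\mathrm{df}$-homogeneous elements. The coproduct $\Delta$ is the algebra morphism with $\Delta(H_n)=\sum_{k=0}^nH_k\otimes H_{n-k}$ and $\Delta(\tilde H_n)=\sum_{k=0}^n(\tilde H_k\otimes H_{n-k}+H_{n-k}\otimes\tilde H_k)$; the counit $\epsilon$ kills all generators. Graded by degree $|\alpha|$, this is a connected graded (signed) Hopf algebra; its antipode $S$ is the unique linear map with $m\circ(S\otimes\mathrm{id})\circ\Delta=u\circ\epsilon=m\circ(\mathrm{id}\otimes S)\circ\Delta$, where $m$ is the product and $u$ the unit. *)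

theory Defs
  imports Complex_Main "HOL-Library.Poly_Mapping"
begin

section \<open>Dotted compositions\<close>

datatype entry = Undotted nat | Dotted nat

primrec val :: "entry \<Rightarrow> nat" where
  "val (Undotted n) = n"
| "val (Dotted n) = n"

primrec is_dotted :: "entry \<Rightarrow> bool" where
  "is_dotted (Undotted n) = False"
| "is_dotted (Dotted n) = True"

text \<open>Undotted entries are positive, dotted entries may be zero.\<close>

primrec admissible :: "entry \<Rightarrow> bool" where
  "admissible (Undotted n) = (0 < n)"
| "admissible (Dotted n) = True"

typedef dcomp = "{xs :: entry list. \<forall>e \<in> set xs. admissible e}"
  morphisms entries of_entries
  by (rule exI[of _ "[]"]) simp

setup_lifting type_definition_dcomp

text \<open>The monoid of dotted compositions under concatenation is the free monoid on
  the admissible entries.\<close>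

instantiation dcomp :: monoid_add
begin

lift_definition zero_dcomp :: dcomp is "[]" by simp

lift_definition plus_dcomp :: "dcomp \<Rightarrow> dcomp \<Rightarrow> dcomp" is "(@)" by auto

instance by standard (transfer; simp)+

end

definition len :: "dcomp \<Rightarrow> nat" where
  "len \<alpha> = length (entries \<alpha>)"

definition df :: "dcomp \<Rightarrow> nat" where
  "df \<alpha> = length (filter is_dotted (entries \<alpha>))"

lift_definition rev_dcomp :: "dcomp \<Rightarrow> dcomp" is rev by simp

text \<open>The sum of two dotted entries is left unspecified.\<close>

fun oplus :: "entry \<Rightarrow> entry \<Rightarrow> entry" where
  "oplus (Undotted m) (Undotted n) = Undotted (m + n)"
| "oplus (Undotted m) (Dotted n) = Dotted (m + n)"
| "oplus (Dotted m) (Undotted n) = Dotted (m + n)"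
| "oplus (Dotted m) (Dotted n) = undefined"

inductive merge_step :: "dcomp \<Rightarrow> dcomp \<Rightarrow> bool" where
  "\<lbrakk>entries \<alpha> = us @ x # y # vs; \<not> (is_dotted x \<and> is_dotted y);
    entries \<beta> = us @ oplus x y # vs\<rbrakk> \<Longrightarrow> merge_step \<alpha> \<beta>"

definition dcomp_le :: "dcomp \<Rightarrow> dcomp \<Rightarrow> bool" (infix \<open>\<preceq>\<close> 50) where
  "\<alpha> \<preceq> \<beta> \<longleftrightarrow> merge_step\<^sup>*\<^sup>* \<alpha> \<beta>"

definition size_dc :: "dcomp \<Rightarrow> nat" where
  "size_dc \<alpha> = df \<alpha> + sum_list (map val (entries \<alpha>))"

lemma size_merge_step:
  assumes "merge_step \<alpha> \<beta>" shows "size_dc \<alpha> = size_dc \<beta>"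
  using assms
proof cases
  case (1 us x y vs)
  then show ?thesis
    by (cases x; cases y) (auto simp: size_dc_def df_def)
qed

lemma size_dcomp_le: "\<alpha> \<preceq> \<beta> \<Longrightarrow> size_dc \<alpha> = size_dc \<beta>"
  unfolding dcomp_le_def by (induction rule: rtranclp_induct) (auto dest: size_merge_step)

lemma finite_size_dc: "finite {\<alpha>. size_dc \<alpha> = n}"
proof -
  let ?E = "Undotted ` {..n} \<union> Dotted ` {..n}"
  have len: "length xs \<le> length (filter is_dotted xs) + sum_list (map val xs)"
    if "\<forall>e\<in>set xs. admissible e" for xs
    using that
  proof (induction xs)
    case (Cons e xs) then show ?case by (cases e) auto
  qed simp
  have "entries ` {\<alpha>. size_dc \<alpha> = n} \<subseteq> {xs. set xs \<subseteq> ?E \<and> length xs \<le> n}"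
  proof (intro image_subsetI CollectI conjI subsetI)
    fix \<alpha> assume a: "\<alpha> \<in> {\<alpha>. size_dc \<alpha> = n}"
    then show "length (entries \<alpha>) \<le> n"
      using len[of "entries \<alpha>"] entries[of \<alpha>] by (auto simp: size_dc_def df_def)
    fix e assume "e \<in> set (entries \<alpha>)"
    then have "val e \<le> n"
      using a member_le_sum_list[of "val e" "map val (entries \<alpha>)"] by (auto simp: size_dc_def)
    then show "e \<in> ?E" by (cases e) auto
  qed
  moreover have "finite {xs. set xs \<subseteq> ?E \<and> length xs \<le> n}"
    by (rule finite_lists_length_le) simp
  ultimately show ?thesis
    by (meson entries_inject finite_imageD finite_subset inj_onI)
qed

lemma finite_dcomp_below: "finite {\<beta>. \<beta> \<preceq> \<alpha>}"
  by (rule finite_subset[OF _ finite_size_dc[of "size_dc \<alpha>"]]) (auto dest: size_dcomp_le)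


section \<open>Linear algebra on free modules over the rationals\<close>

text \<open>The vector space with basis \<open>'a\<close> is \<^typ>\<open>'a \<Rightarrow>\<^sub>0 rat\<close>.\<close>

definition scale :: "rat \<Rightarrow> ('a \<Rightarrow>\<^sub>0 rat) \<Rightarrow> ('a \<Rightarrow>\<^sub>0 rat)" where
  "scale c f = Poly_Mapping.map ((*) c) f"

lemma lookup_scale [simp]: "Poly_Mapping.lookup (scale c f) a = c * Poly_Mapping.lookup f a"
  unfolding scale_def by transfer (auto simp: when_def)

interpretation pm: vector_space "scale :: rat \<Rightarrow> ('a \<Rightarrow>\<^sub>0 rat) \<Rightarrow> _"
  by unfold_locales (auto intro!: poly_mapping_eqI simp: lookup_add algebra_simps)

text \<open>Linear extension of a map given on basis elements.\<close>

definition lin_ext :: "('a \<Rightarrow> ('b \<Rightarrow>\<^sub>0 rat)) \<Rightarrow> ('a \<Rightarrow>\<^sub>0 rat) \<Rightarrow> ('b \<Rightarrow>\<^sub>0 rat)" where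
  "lin_ext \<phi> f = (\<Sum>a\<in>Poly_Mapping.keys f. scale (Poly_Mapping.lookup f a) (\<phi> a))"

lemma lin_ext_superset:
  "finite A \<Longrightarrow> Poly_Mapping.keys f \<subseteq> A \<Longrightarrow>
     lin_ext \<phi> f = (\<Sum>a\<in>A. scale (Poly_Mapping.lookup f a) (\<phi> a))"
  unfolding lin_ext_def by (rule sum.mono_neutral_left) (auto simp: in_keys_iff)

lemma lin_ext_single [simp]: "lin_ext \<phi> (Poly_Mapping.single a c) = scale c (\<phi> a)"
  by (subst lin_ext_superset[of "{a}"]) auto

lemma lin_ext_add: "lin_ext \<phi> (f + g) = lin_ext \<phi> f + lin_ext \<phi> g"
proof -
  let ?A = "Poly_Mapping.keys f \<union> Poly_Mapping.keys g"
  have "Poly_Mapping.keys (f + g) \<subseteq> ?A" by (rule Poly_Mapping.keys_add)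
  then show ?thesis
    by (simp add: lin_ext_superset[of ?A] lookup_add pm.scale_left_distrib sum.distrib)
qed

lemma lin_ext_scale: "lin_ext \<phi> (scale c f) = scale c (lin_ext \<phi> f)"
proof -
  have "Poly_Mapping.keys (scale c f) \<subseteq> Poly_Mapping.keys f" by (auto simp: in_keys_iff)
  then show ?thesis
    by (simp add: lin_ext_superset[of "Poly_Mapping.keys f"] pm.scale_sum_right)
qed

lemma linear_lin_ext: "Vector_Spaces.linear scale scale (lin_ext \<phi>)"
  by unfold_locales (simp_all add: lin_ext_add lin_ext_scale)

lemma linear_eq_on_basis:
  assumes "Vector_Spaces.linear scale scale F" "Vector_Spaces.linear scale scale G"
    and "\<And>a. F (Poly_Mapping.single a 1) = G (Poly_Mapping.single a 1)"
  shows "F f = G f"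
proof -
  interpret F: Vector_Spaces.linear scale scale F by fact
  interpret G: Vector_Spaces.linear scale scale G by fact
  have f: "f = (\<Sum>a\<in>Poly_Mapping.keys f. scale (Poly_Mapping.lookup f a) (Poly_Mapping.single a 1))"
    by (rule poly_mapping_eqI)
       (auto simp: lookup_sum lookup_single when_def in_keys_iff if_distrib sum.delta cong: if_cong)
  show ?thesis
    by (subst (1 2) f) (simp add: F.sum G.sum F.scale G.scale assms(3))
qed


section \<open>The superalgebra of noncommutative symmetric functions in superspace\<close>

text \<open>The monoid algebra of the free monoid of dotted compositions, i.e. the free associative
  unital algebra on one generator for each admissible entry.\<close>

type_synonym sNSym = "dcomp \<Rightarrow>\<^sub>0 rat"

definition Hn :: "nat \<Rightarrow> sNSym" where
  "Hn n = (if n = 0 then 1 else Poly_Mapping.single (of_entries [Undotted n]) 1)"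

definition Hdot :: "nat \<Rightarrow> sNSym" where
  "Hdot n = Poly_Mapping.single (of_entries [Dotted n]) 1"

primrec Hgen :: "entry \<Rightarrow> sNSym" where
  "Hgen (Undotted n) = Hn n"
| "Hgen (Dotted n) = Hdot n"

definition H :: "dcomp \<Rightarrow> sNSym" where
  "H \<alpha> = prod_list (map Hgen (entries \<alpha>))"

lemma H_conv_single: "H \<alpha> = Poly_Mapping.single \<alpha> 1"
proof -
  have "prod_list (map Hgen xs) = Poly_Mapping.single (of_entries xs) 1"
    if "\<forall>e\<in>set xs. admissible e" for xs
    using that
  proof (induction xs)
    case Nil
    then show ?case by (simp add: zero_dcomp_def flip: single_one)
  next
    case (Cons e xs)
    have "of_entries [e] + of_entries xs = of_entries (e # xs)"
      using Cons.prems by (simp add: plus_dcomp_def of_entries_inverse)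
    with Cons show ?case
      by (cases e) (simp_all add: Hn_def Hdot_def mult_single)
  qed
  from this[of "entries \<alpha>"] show ?thesis
    using entries[of \<alpha>] by (simp add: H_def entries_inverse)
qed

lemma H_add: "H (\<alpha> + \<beta>) = H \<alpha> * H \<beta>"
  by (simp add: H_conv_single mult_single)


section \<open>The tensor square and its signed multiplication\<close>

text \<open>The basis element indexed by \<open>(\<alpha>, \<beta>)\<close> stands for the tensor of \<open>H \<alpha>\<close> and \<open>H \<beta>\<close>.\<close>

type_synonym sNSym2 = "(dcomp \<times> dcomp) \<Rightarrow>\<^sub>0 rat"

definition tensor :: "sNSym \<Rightarrow> sNSym \<Rightarrow> sNSym2" (infixr \<open>\<otimes>\<close> 75) where
  "f \<otimes> g = lin_ext (\<lambda>\<alpha>. lin_ext (\<lambda>\<beta>. Poly_Mapping.single (\<alpha>, \<beta>) 1) g) f"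

text \<open>Not the multiplication of the monoid algebra of the product monoid: moving \<open>H \<gamma>\<close>
  past \<open>H \<beta>\<close> costs a sign.\<close>

definition tmult :: "sNSym2 \<Rightarrow> sNSym2 \<Rightarrow> sNSym2" (infixl \<open>\<odot>\<close> 70) where
  "t \<odot> u = lin_ext (\<lambda>(\<alpha>, \<beta>). lin_ext (\<lambda>(\<gamma>, \<delta>).
     scale ((-1) ^ (df \<beta> * df \<gamma>)) ((H \<alpha> * H \<gamma>) \<otimes> (H \<beta> * H \<delta>))) u) t"

definition tone :: sNSym2 where
  "tone = 1 \<otimes> 1"

definition tmap :: "(sNSym \<Rightarrow> sNSym) \<Rightarrow> (sNSym \<Rightarrow> sNSym) \<Rightarrow> sNSym2 \<Rightarrow> sNSym2" where
  "tmap F G = lin_ext (\<lambda>(\<alpha>, \<beta>). F (H \<alpha>) \<otimes> G (H \<beta>))"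


section \<open>Hopf structure and antipode\<close>

definition mult_map :: "sNSym2 \<Rightarrow> sNSym" where
  "mult_map = lin_ext (\<lambda>(\<alpha>, \<beta>). H \<alpha> * H \<beta>)"

definition unit_map :: "rat \<Rightarrow> sNSym" where
  "unit_map c = scale c 1"

text \<open>The coefficient of the empty composition is the algebra morphism that kills all
  generators; see \<open>counit_mult\<close> and \<open>counit_Hn\<close> below.\<close>

definition counit :: "sNSym \<Rightarrow> rat" where
  "counit f = Poly_Mapping.lookup f 0"

primrec coprod_gen :: "entry \<Rightarrow> sNSym2" where
  "coprod_gen (Undotted n) = (\<Sum>k\<le>n. Hn k \<otimes> Hn (n - k))"
| "coprod_gen (Dotted n) = (\<Sum>k\<le>n. Hdot k \<otimes> Hn (n - k) + Hn (n - k) \<otimes> Hdot k)"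

text \<open>The extension of \<open>coprod_gen\<close> to an algebra morphism; see \<open>coprod_mult\<close> below.\<close>

definition coprod :: "sNSym \<Rightarrow> sNSym2" where
  "coprod = lin_ext (\<lambda>\<alpha>. foldr (\<odot>) (map coprod_gen (entries \<alpha>)) tone)"

definition is_antipode :: "(sNSym \<Rightarrow> sNSym) \<Rightarrow> bool" where
  "is_antipode S \<longleftrightarrow> Vector_Spaces.linear scale scale S \<and>
     mult_map \<circ> tmap S id \<circ> coprod = unit_map \<circ> counit \<and>
     mult_map \<circ> tmap id S \<circ> coprod = unit_map \<circ> counit"

definition antipode :: "sNSym \<Rightarrow> sNSym" where
  "antipode = (THE S. is_antipode S)"


subsection \<open>The maps above have the intended characterizations\<close>

lemma counit_Hn: "0 < n \<Longrightarrow> counit (Hn n) = 0"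
  by (auto simp: counit_def Hn_def lookup_single when_def zero_dcomp_def of_entries_inject)

lemma counit_Hdot: "counit (Hdot n) = 0"
  by (auto simp: counit_def Hdot_def lookup_single when_def zero_dcomp_def of_entries_inject)

lemma counit_one: "counit 1 = 1"
  by (simp add: counit_def lookup_one)

lemma dcomp_add_eq_0: "\<alpha> + \<beta> = (0::dcomp) \<longleftrightarrow> \<alpha> = 0 \<and> \<beta> = 0"
  by transfer auto

lemma counit_mult: "counit (f * g) = counit f * counit g"
proof -
  have inner: "Sum_any (\<lambda>q. Poly_Mapping.lookup g q when 0 = l + q) =
      (Poly_Mapping.lookup g 0 when l = 0)" for l
  proof -
    have "(\<lambda>q. Poly_Mapping.lookup g q when 0 = l + q) =
        (\<lambda>q. (Poly_Mapping.lookup g 0 when l = 0) when q = 0)"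
      using dcomp_add_eq_0[of l] by (auto simp: when_def fun_eq_iff)
    then show ?thesis by (simp only: Sum_any_when_equal)
  qed
  have "(\<lambda>l. Poly_Mapping.lookup f l * (Poly_Mapping.lookup g 0 when l = 0)) =
      (\<lambda>l. Poly_Mapping.lookup f 0 * Poly_Mapping.lookup g 0 when l = 0)"
    by (auto simp: when_def)
  then show ?thesis by (simp only: counit_def lookup_mult inner Sum_any_when_equal)
qed

lemma df_add [simp]: "df (\<alpha> + \<beta>) = df \<alpha> + df \<beta>"
  by (simp add: df_def plus_dcomp.rep_eq)

lemma df_zero [simp]: "df 0 = 0"
  by (simp add: df_def zero_dcomp.rep_eq)

lemma tensor_H: "H \<alpha> \<otimes> H \<beta> = Poly_Mapping.single (\<alpha>, \<beta>) 1"
  by (simp add: tensor_def H_conv_single)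

lemma tmult_single:
  "Poly_Mapping.single (\<alpha>, \<beta>) 1 \<odot> Poly_Mapping.single (\<gamma>, \<delta>) 1 =
     scale ((-1) ^ (df \<beta> * df \<gamma>)) (Poly_Mapping.single (\<alpha> + \<gamma>, \<beta> + \<delta>) 1)"
  by (simp add: tmult_def tensor_H flip: H_add)

lemma linear_tmult_left: "Vector_Spaces.linear scale scale (\<lambda>t. t \<odot> u)"
  unfolding tmult_def by (rule linear_lin_ext)

lemma linear_tmult_right: "Vector_Spaces.linear scale scale (\<lambda>u. t \<odot> u)"
  unfolding tmult_def lin_ext_def[of _ t]
  by unfold_locales
     (simp_all add: case_prod_unfold lin_ext_add lin_ext_scale pm.scale_right_distrib
        sum.distrib pm.scale_sum_right mult.commute)

lemma linear_comp:
  "Vector_Spaces.linear scale scale F \<Longrightarrow> Vector_Spaces.linear scale scale G \<Longrightarrow>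
     Vector_Spaces.linear scale scale (\<lambda>x. F (G x))"
  using Vector_Spaces.linear_compose[of scale scale G scale F] by (simp add: o_def)

lemma tmult_assoc: "(t \<odot> u) \<odot> v = t \<odot> (u \<odot> v)"
proof -
  interpret L: Vector_Spaces.linear scale scale "\<lambda>t. t \<odot> w" for w
    by (rule linear_tmult_left)
  interpret R: Vector_Spaces.linear scale scale "\<lambda>t. w \<odot> t" for w
    by (rule linear_tmult_right)
  let ?s = "\<lambda>p. Poly_Mapping.single p (1::rat)"
  have 1: "(?s p \<odot> ?s q) \<odot> ?s r = ?s p \<odot> (?s q \<odot> ?s r)" for p q r
    by (cases p; cases q; cases r)
       (simp add: tmult_single L.scale R.scale add.assoc power_add algebra_simps)
  have 2: "(?s p \<odot> ?s q) \<odot> v = ?s p \<odot> (?s q \<odot> v)" for p q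
    by (rule linear_eq_on_basis[of "\<lambda>v. (?s p \<odot> ?s q) \<odot> v"])
       (rule linear_tmult_right linear_comp[OF linear_tmult_right linear_tmult_right] 1)+
  have 3: "(?s p \<odot> u) \<odot> v = ?s p \<odot> (u \<odot> v)" for p
    by (rule linear_eq_on_basis[of "\<lambda>u. (?s p \<odot> u) \<odot> v"])
       (rule linear_comp[OF linear_tmult_left linear_tmult_right]
          linear_comp[OF linear_tmult_right linear_tmult_left] 2)+
  show ?thesis
    by (rule linear_eq_on_basis[of "\<lambda>t. (t \<odot> u) \<odot> v"])
       (rule linear_comp[OF linear_tmult_left linear_tmult_left] linear_tmult_left 3)+
qed

lemma tone_single: "tone = Poly_Mapping.single (0, 0) 1"
  unfolding tone_def by (metis H_conv_single tensor_H single_one)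

lemma tmult_tone_left: "tone \<odot> t = t"
  by (rule linear_eq_on_basis[OF linear_tmult_right])
     (auto simp: tone_single tmult_single intro!: pm.linear_id[unfolded id_def])

lemma tmult_tone_right: "t \<odot> tone = t"
  by (rule linear_eq_on_basis[OF linear_tmult_left])
     (auto simp: tone_single tmult_single intro!: pm.linear_id[unfolded id_def])

lemma linear_coprod: "Vector_Spaces.linear scale scale coprod"
  unfolding coprod_def by (rule linear_lin_ext)

lemma coprod_one: "coprod 1 = tone"
  unfolding coprod_def by (simp add: zero_dcomp.rep_eq flip: single_one)

lemma coprod_single_add:
  "coprod (Poly_Mapping.single (\<alpha> + \<beta>) 1) =
     coprod (Poly_Mapping.single \<alpha> 1) \<odot> coprod (Poly_Mapping.single \<beta> 1)"
proof -
  have *: "foldr (\<odot>) xs t = foldr (\<odot>) xs tone \<odot> t" for xs t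
    by (induction xs) (simp_all add: tmult_assoc tmult_tone_left)
  show ?thesis
    unfolding coprod_def by (simp add: plus_dcomp.rep_eq) (rule *)
qed

lemma scale_conv_mult: "scale c (f :: sNSym) = Poly_Mapping.single 0 c * f"
  unfolding scale_def by (rule mult_map_scale_conv_mult)

lemma linear_mult_left: "Vector_Spaces.linear scale scale (\<lambda>f. f * (g :: sNSym))"
  by unfold_locales (simp_all add: distrib_right scale_conv_mult mult.assoc)

lemma single_0_commute: "Poly_Mapping.single 0 c * f = f * Poly_Mapping.single 0 c"
  for f :: sNSym
proof (rule linear_eq_on_basis[of "\<lambda>f. Poly_Mapping.single 0 c * f"])
  show "Vector_Spaces.linear scale scale (\<lambda>f :: sNSym. Poly_Mapping.single 0 c * f)"
    unfolding scale_conv_mult[symmetric] by (rule pm.linear_scale_self)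
qed (rule linear_mult_left, simp add: mult_single)

lemma linear_mult_right: "Vector_Spaces.linear scale scale (\<lambda>g. (f :: sNSym) * g)"
  by unfold_locales
     (simp_all add: distrib_left scale_conv_mult single_0_commute mult.assoc)

lemma coprod_mult: "coprod (f * g) = coprod f \<odot> coprod g"
proof -
  have 1: "coprod (Poly_Mapping.single a 1 * Poly_Mapping.single b 1) =
      coprod (Poly_Mapping.single a 1) \<odot> coprod (Poly_Mapping.single b 1)" for a b
    by (simp add: mult_single coprod_single_add)
  have 2: "coprod (Poly_Mapping.single a 1 * g) = coprod (Poly_Mapping.single a 1) \<odot> coprod g" for a
    by (rule linear_eq_on_basis[of "\<lambda>g. coprod (Poly_Mapping.single a 1 * g)"])
       (rule linear_comp[OF linear_coprod linear_mult_right] linear_comp[OF linear_tmult_right linear_coprod] 1)+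
  show ?thesis
    by (rule linear_eq_on_basis[of "\<lambda>f. coprod (f * g)"])
       (rule linear_comp[OF linear_coprod linear_mult_left] linear_comp[OF linear_tmult_left linear_coprod] 2)+
qed

lemma coprod_Hn: "coprod (Hn n) = (\<Sum>k\<le>n. Hn k \<otimes> Hn (n - k))"
proof (cases "n = 0")
  case True
  then show ?thesis by (simp add: Hn_def coprod_one tone_def)
next
  case False
  then show ?thesis
    by (simp add: Hn_def[of n] coprod_def of_entries_inverse tmult_tone_right)
qed

lemma coprod_Hdot:
  "coprod (Hdot n) = (\<Sum>k\<le>n. Hdot k \<otimes> Hn (n - k) + Hn (n - k) \<otimes> Hdot k)"
  by (simp add: Hdot_def[of n] coprod_def of_entries_inverse tmult_tone_right)

end

theory Submission
  imports Defs
begin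

text \<open>
  The antipode is determined by the Hopf structure, so it suffices to show that the linear map
  \<open>S0\<close> sending \<open>H \<alpha>\<close> to the right-hand side of the formula is an antipode and
  that there is only one antipode.

  A refinement of a concatenation splits uniquely into refinements of its two parts
  (\<open>refinement_sum_add\<close>): undoing a merge replaces one entry, which lies in one of the
  parts, and the position of the border is determined by the degree. Hence \<open>S0\<close> reverses products up
  to the usual sign of a superalgebra (\<open>S0_H_mult\<close>), where
  \<open>binomial (m + n) 2 = binomial m 2 + binomial n 2 + m * n\<close> accounts for the prefactor.

  On a generator, the refinements of a single entry are exactly the nonempty dotted compositions
  with the same number of dots and the same sum of values. Splitting off the first or the last
  entry of such a composition, which changes the parity of its length, gives
  \<open>m (S0 \<otimes> id) \<Delta> = 0 = m (id \<otimes> S0) \<Delta>\<close> there (\<open>conv_S0_gen\<close>).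
  Because \<open>S0\<close> reverses products, the vanishing of \<open>m (S0 \<otimes> id)\<close> on a
  homogeneous left factor of a product in the tensor square forces it to vanish on the whole
  product, and likewise for \<open>m (id \<otimes> S0)\<close> and the right factor; since the coproduct is
  multiplicative, both identities extend from generators to all \<open>H \<alpha>\<close>.

  For uniqueness, \<open>\<Delta> (H \<alpha>)\<close> is \<open>H \<alpha> \<otimes> 1\<close> plus terms whose left tensor factor
  has smaller degree (\<open>coprod_triangular\<close>), so the identity \<open>m (S \<otimes> id) \<Delta> = u \<epsilon>\<close>
  computes \<open>S (H \<alpha>)\<close> recursively.
\<close>

section \<open>Refinements of dotted compositions\<close>

definition weight :: "dcomp \<Rightarrow> nat" where
  "weight \<alpha> = sum_list (map val (entries \<alpha>))"

text \<open>Meaningful only for admissible \<open>e\<close>.\<close>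

definition gen :: "entry \<Rightarrow> dcomp" where
  "gen e = of_entries [e]"

lemma entries_gen: "admissible e \<Longrightarrow> entries (gen e) = [e]"
  by (simp add: gen_def of_entries_inverse)

lemma entries_eq_iff: "entries \<alpha> = entries \<beta> \<longleftrightarrow> \<alpha> = \<beta>"
  by (simp add: entries_inject)

lemma df_gen: "admissible e \<Longrightarrow> df (gen e) = (if is_dotted e then 1 else 0)"
  by (simp add: df_def entries_gen)

lemma weight_gen: "admissible e \<Longrightarrow> weight (gen e) = val e"
  by (simp add: weight_def entries_gen)

lemma len_gen: "admissible e \<Longrightarrow> len (gen e) = 1"
  by (simp add: len_def entries_gen)

lemma weight_add [simp]: "weight (\<alpha> + \<beta>) = weight \<alpha> + weight \<beta>"
  by (simp add: weight_def plus_dcomp.rep_eq)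

lemma weight_zero [simp]: "weight 0 = 0"
  by (simp add: weight_def zero_dcomp.rep_eq)

lemma len_add [simp]: "len (\<alpha> + \<beta>) = len \<alpha> + len \<beta>"
  by (simp add: len_def plus_dcomp.rep_eq)

lemma len_zero [simp]: "len 0 = 0"
  by (simp add: len_def zero_dcomp.rep_eq)

lemma size_dc_eq: "size_dc \<alpha> = df \<alpha> + weight \<alpha>"
  by (simp add: size_dc_def weight_def)

lemma dcomp_cases:
  obtains "\<alpha> = 0" | e \<beta> where "admissible e" "\<alpha> = gen e + \<beta>"
proof (cases "entries \<alpha>")
  case Nil
  then show ?thesis using that(1) by (metis entries_eq_iff zero_dcomp.rep_eq)
next
  case (Cons e xs)
  with entries[of \<alpha>] have adm: "admissible e" "\<forall>x\<in>set xs. admissible x" by auto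
  then have "entries \<alpha> = entries (gen e + of_entries xs)"
    using Cons by (simp add: plus_dcomp.rep_eq entries_gen of_entries_inverse)
  with adm(1) show ?thesis using that(2) by (simp add: entries_eq_iff)
qed

lemma dcomp_induct [case_names zero add]:
  assumes "P 0" and step: "\<And>e \<beta>. admissible e \<Longrightarrow> P \<beta> \<Longrightarrow> P (gen e + \<beta>)"
  shows "P \<alpha>"
proof (induction "len \<alpha>" arbitrary: \<alpha>)
  case 0
  then show ?case using assms(1) by (cases \<alpha> rule: dcomp_cases) (auto simp: len_gen)
next
  case (Suc n)
  then show ?case using assms(1) step by (cases \<alpha> rule: dcomp_cases) (auto simp: len_gen)
qed

lemma gen_add_inject:
  assumes "admissible e" "admissible e'"
  shows "gen e + \<beta> = gen e' + \<beta>' \<longleftrightarrow> e = e' \<and> \<beta> = \<beta>'"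
  using assms by (auto simp: plus_dcomp.rep_eq entries_gen simp flip: entries_eq_iff)

lemma size_dc_eq_0_iff: "size_dc \<alpha> = 0 \<longleftrightarrow> \<alpha> = 0"
proof (cases \<alpha> rule: dcomp_cases)
  case 1 then show ?thesis by (simp add: size_dc_eq)
next
  case (2 e \<beta>)
  then have "size_dc \<alpha> > 0"
    by (cases e) (auto simp: size_dc_eq df_gen weight_gen)
  then show ?thesis by (auto simp: size_dc_eq)
qed

lemma size_dc_add: "size_dc (\<alpha> + \<beta>) = size_dc \<alpha> + size_dc \<beta>"
  by (simp add: size_dc_eq)

lemma rev_dcomp_simps:
  "rev_dcomp 0 = 0" "rev_dcomp (\<alpha> + \<beta>) = rev_dcomp \<beta> + rev_dcomp \<alpha>"
  "rev_dcomp (rev_dcomp \<alpha>) = \<alpha>"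
  by (transfer; simp)+

lemma rev_dcomp_gen: "admissible e \<Longrightarrow> rev_dcomp (gen e) = gen e"
  by (simp add: rev_dcomp.rep_eq entries_gen flip: entries_eq_iff)

lemma rev_dcomp_invariants: "df (rev_dcomp \<alpha>) = df \<alpha>" "weight (rev_dcomp \<alpha>) = weight \<alpha>"
  by (simp_all add: df_def weight_def rev_dcomp.rep_eq flip: rev_filter rev_map)

lemma merge_step_invariants:
  assumes "merge_step \<alpha> \<beta>"
  shows "df \<alpha> = df \<beta>" "weight \<alpha> = weight \<beta>" "\<alpha> \<noteq> 0" "\<beta> \<noteq> 0"
proof -
  obtain us x y vs where *: "entries \<alpha> = us @ x # y # vs" "\<not> (is_dotted x \<and> is_dotted y)"
      "entries \<beta> = us @ oplus x y # vs"
    using assms by cases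
  then show "df \<alpha> = df \<beta>" "weight \<alpha> = weight \<beta>"
    by (cases x; cases y; auto simp: weight_def df_def)+
  show "\<alpha> \<noteq> 0" "\<beta> \<noteq> 0"
    using * by (auto simp: zero_dcomp.rep_eq simp flip: entries_eq_iff)
qed

lemma refines_invariants:
  "\<alpha> \<preceq> \<beta> \<Longrightarrow> df \<alpha> = df \<beta> \<and> weight \<alpha> = weight \<beta> \<and> (\<alpha> = 0 \<longleftrightarrow> \<beta> = 0)"
  unfolding dcomp_le_def by (induction rule: rtranclp_induct) (auto dest: merge_step_invariants)

lemma refines_zero_iff: "\<beta> \<preceq> 0 \<longleftrightarrow> \<beta> = 0"
  using refines_invariants[of \<beta> 0] by (auto simp: dcomp_le_def)

text \<open>Merging all the way down to one entry is blocked only by two dotted entries, and a composition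
  with at most one dot never contains two of them. So any two neighbours may be merged, which
  shortens the composition.\<close>

lemma refines_gen_iff:
  assumes e: "admissible e"
  shows "\<beta> \<preceq> gen e \<longleftrightarrow> \<beta> \<noteq> 0 \<and> df \<beta> = df (gen e) \<and> weight \<beta> = val e"
proof
  assume "\<beta> \<preceq> gen e"
  then show "\<beta> \<noteq> 0 \<and> df \<beta> = df (gen e) \<and> weight \<beta> = val e"
    using refines_invariants[of \<beta> "gen e"] e
    by (auto simp: weight_gen zero_dcomp.rep_eq entries_gen simp flip: entries_eq_iff)
next
  assume "\<beta> \<noteq> 0 \<and> df \<beta> = df (gen e) \<and> weight \<beta> = val e"
  then show "\<beta> \<preceq> gen e"
  proof (induction "len \<beta>" arbitrary: \<beta> rule: less_induct)
    case less
    consider "entries \<beta> = []" | x where "entries \<beta> = [x]" | x y vs where "entries \<beta> = x # y # vs"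
      by (metis list.exhaust)
    then show ?case
    proof cases
      case 1
      then show ?thesis using less.prems by (metis entries_eq_iff zero_dcomp.rep_eq)
    next
      case (2 x)
      have "x = e"
        using less.prems 2 e by (cases x; cases e) (auto simp: df_def weight_def entries_gen)
      then have "\<beta> = gen e" using 2 e by (simp add: entries_gen flip: entries_eq_iff)
      then show ?thesis by (simp add: dcomp_le_def)
    next
      case (3 x y vs)
      have nd: "\<not> (is_dotted x \<and> is_dotted y)"
        using less.prems 3 e by (cases e) (auto simp: df_def entries_gen)
      have adm: "\<forall>z\<in>set (oplus x y # vs). admissible z"
        using entries[of \<beta>] 3 nd by (cases x; cases y) auto
      let ?\<gamma> = "of_entries (oplus x y # vs)"
      have \<gamma>: "entries ?\<gamma> = oplus x y # vs"
        using adm by (simp add: of_entries_inverse)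
      have step: "merge_step \<beta> ?\<gamma>"
        by (rule merge_step.intros[of _ "[]" x y vs]) (use 3 nd \<gamma> in auto)
      have "len ?\<gamma> < len \<beta>" using 3 \<gamma> by (simp add: len_def)
      then have "?\<gamma> \<preceq> gen e"
        using less.hyps less.prems merge_step_invariants[OF step] by auto
      then show ?thesis using step unfolding dcomp_le_def by (rule converse_rtranclp_into_rtranclp[rotated])
    qed
  qed
qed

lemma merge_step_add:
  assumes "merge_step \<alpha> \<beta>"
  shows "merge_step (\<alpha> + \<gamma>) (\<beta> + \<gamma>)" "merge_step (\<gamma> + \<alpha>) (\<gamma> + \<beta>)"
proof -
  obtain us x y vs where *: "entries \<alpha> = us @ x # y # vs" "\<not> (is_dotted x \<and> is_dotted y)"
      "entries \<beta> = us @ oplus x y # vs"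
    using assms by cases
  show "merge_step (\<alpha> + \<gamma>) (\<beta> + \<gamma>)"
    by (rule merge_step.intros[of _ us x y "vs @ entries \<gamma>"]) (use * in \<open>auto simp: plus_dcomp.rep_eq\<close>)
  show "merge_step (\<gamma> + \<alpha>) (\<gamma> + \<beta>)"
    by (rule merge_step.intros[of _ "entries \<gamma> @ us" x y vs]) (use * in \<open>auto simp: plus_dcomp.rep_eq\<close>)
qed

lemma refines_add: 
  assumes "\<alpha> \<preceq> \<beta>" "\<gamma> \<preceq> \<delta>" shows "\<alpha> + \<gamma> \<preceq> \<beta> + \<delta>"
proof -
  have "merge_step\<^sup>*\<^sup>* (\<alpha> + \<gamma>) (\<beta> + \<gamma>)"
    using assms(1) unfolding dcomp_le_def
    by (induction rule: rtranclp_induct) (auto intro: merge_step_add rtranclp.rtrancl_into_rtrancl)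
  moreover have "merge_step\<^sup>*\<^sup>* (\<beta> + \<gamma>) (\<beta> + \<delta>)"
    using assms(2) unfolding dcomp_le_def
    by (induction rule: rtranclp_induct) (auto intro: merge_step_add rtranclp.rtrancl_into_rtrancl)
  ultimately show ?thesis unfolding dcomp_le_def by (rule rtranclp_trans)
qed

text \<open>The entry produced by a merge lies on one side of the border between \<open>\<gamma>\<close> and
  \<open>\<delta>\<close>; undoing the merge there leaves the other side alone.\<close>

lemma merge_step_add_split:
  assumes "merge_step \<beta> (\<gamma> + \<delta>)"
  shows "\<exists>\<gamma>' \<delta>'. \<beta> = \<gamma>' + \<delta>' \<and> \<gamma>' \<preceq> \<gamma> \<and> \<delta>' \<preceq> \<delta>"
  using assms
proof cases
  case (1 us x y vs)
  have eq: "entries \<gamma> @ entries \<delta> = us @ oplus x y # vs"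
    using 1 by (simp add: plus_dcomp.rep_eq)
  have adm: "\<forall>z\<in>set (us @ x # y # vs). admissible z"
    using entries[of \<beta>] 1 by auto
  from eq consider ws where "entries \<gamma> = us @ oplus x y # ws" "vs = ws @ entries \<delta>"
    | ws where "us = entries \<gamma> @ ws" "entries \<delta> = ws @ oplus x y # vs"
    by (auto simp: append_eq_append_conv2 append_eq_Cons_conv Cons_eq_append_conv)
  then show ?thesis
  proof cases
    case (1 ws)
    let ?\<gamma>' = "of_entries (us @ x # y # ws)"
    have \<gamma>': "entries ?\<gamma>' = us @ x # y # ws"
      using adm 1 by (subst of_entries_inverse) auto
    have "merge_step ?\<gamma>' \<gamma>"
      by (rule merge_step.intros[OF \<gamma>']) (use 1 \<open>\<not> (is_dotted x \<and> is_dotted y)\<close> in auto)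
    moreover have "\<beta> = ?\<gamma>' + \<delta>"
      using \<open>entries \<beta> = _\<close> 1 \<gamma>' by (simp add: plus_dcomp.rep_eq flip: entries_eq_iff)
    ultimately show ?thesis by (auto simp: dcomp_le_def)
  next
    case (2 ws)
    let ?\<delta>' = "of_entries (ws @ x # y # vs)"
    have \<delta>': "entries ?\<delta>' = ws @ x # y # vs"
      using adm 2 by (subst of_entries_inverse) auto
    have "merge_step ?\<delta>' \<delta>"
      by (rule merge_step.intros[OF \<delta>']) (use 2 \<open>\<not> (is_dotted x \<and> is_dotted y)\<close> in auto)
    moreover have "\<beta> = \<gamma> + ?\<delta>'"
      using \<open>entries \<beta> = _\<close> 2 \<delta>' by (simp add: plus_dcomp.rep_eq flip: entries_eq_iff)
    ultimately show ?thesis by (auto simp: dcomp_le_def)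
  qed
qed

lemma refines_add_split:
  assumes "\<beta> \<preceq> \<gamma> + \<delta>"
  shows "\<exists>\<gamma>' \<delta>'. \<beta> = \<gamma>' + \<delta>' \<and> \<gamma>' \<preceq> \<gamma> \<and> \<delta>' \<preceq> \<delta>"
  using assms unfolding dcomp_le_def
proof (induction rule: converse_rtranclp_induct)
  case base
  then show ?case by blast
next
  case (step \<beta> \<beta>')
  then obtain \<gamma>' \<delta>' where *: "\<beta>' = \<gamma>' + \<delta>'" "\<gamma>' \<preceq> \<gamma>" "\<delta>' \<preceq> \<delta>"
    by (auto simp: dcomp_le_def)
  with merge_step_add_split[of \<beta> \<gamma>' \<delta>'] step.hyps(1)
  obtain \<gamma>'' \<delta>'' where "\<beta> = \<gamma>'' + \<delta>''" "\<gamma>'' \<preceq> \<gamma>'" "\<delta>'' \<preceq> \<delta>'"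
    by auto
  with * show ?case by (metis dcomp_le_def rtranclp_trans)
qed

text \<open>Every entry has positive degree, so a prefix is determined by its degree.\<close>

lemma add_eq_same_size_imp_eq:
  assumes "\<alpha> + \<beta> = \<alpha>' + \<beta>'" "size_dc \<alpha> = size_dc \<alpha>'"
  shows "\<alpha> = \<alpha>' \<and> \<beta> = \<beta>'"
  using assms
proof (induction \<alpha> arbitrary: \<alpha>' rule: dcomp_induct)
  case zero
  then have "\<alpha>' = 0" by (metis size_dc_eq_0_iff)
  with zero show ?case by simp
next
  case (add e \<alpha>)
  show ?case
  proof (cases \<alpha>' rule: dcomp_cases)
    case 1
    then have "gen e + \<alpha> = 0" using add.prems by (metis size_dc_eq_0_iff)
    then show ?thesis using add.prems 1 by simp
  next
    case (2 e' \<alpha>'')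
    have "e = e' \<and> \<alpha> + \<beta> = \<alpha>'' + \<beta>'"
      using add.prems(1) 2 add.hyps gen_add_inject by (simp add: add.assoc)
    then show ?thesis using add.IH[of \<alpha>''] add.prems(2) 2 by (simp add: size_dc_add)
  qed
qed

definition refinement_sum :: "dcomp \<Rightarrow> sNSym" where
  "refinement_sum \<alpha> = (\<Sum>\<beta> | \<beta> \<preceq> \<alpha>. scale ((-1) ^ len \<beta>) (H \<beta>))"

lemma scale_mult: "scale a f * scale b g = scale (a * b) (f * (g :: sNSym))"
  by (metis (no_types, lifting) mult.assoc mult_single add_0 scale_conv_mult single_0_commute)

lemma scale_mult_left: "scale c f * g = scale c (f * (g :: sNSym))"
  and scale_mult_right: "f * scale c g = scale c (f * (g :: sNSym))"
  using scale_mult[of c f 1 g] scale_mult[of 1 f c g] by simp_all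

lemma refinement_sum_zero: "refinement_sum 0 = 1"
proof -
  have "{\<beta>. \<beta> \<preceq> 0} = {0}" by (auto simp: refines_zero_iff)
  then show ?thesis by (simp add: refinement_sum_def H_conv_single)
qed

text \<open>The two parts of a refinement of \<open>\<alpha> + \<beta>\<close> are unique, because the first has the
  degree of \<open>\<alpha>\<close>.\<close>

lemma refinement_sum_add: "refinement_sum (\<alpha> + \<beta>) = refinement_sum \<alpha> * refinement_sum \<beta>"
proof -
  have bij: "bij_betw (\<lambda>(\<gamma>, \<delta>). \<gamma> + \<delta>) ({\<gamma>. \<gamma> \<preceq> \<alpha>} \<times> {\<delta>. \<delta> \<preceq> \<beta>}) {\<epsilon>. \<epsilon> \<preceq> \<alpha> + \<beta>}"
    unfolding bij_betw_def
  proof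
    show "inj_on (\<lambda>(\<gamma>, \<delta>). \<gamma> + \<delta>) ({\<gamma>. \<gamma> \<preceq> \<alpha>} \<times> {\<delta>. \<delta> \<preceq> \<beta>})"
      by (auto simp: inj_on_def dest!: size_dcomp_le add_eq_same_size_imp_eq)
    show "(\<lambda>(\<gamma>, \<delta>). \<gamma> + \<delta>) ` ({\<gamma>. \<gamma> \<preceq> \<alpha>} \<times> {\<delta>. \<delta> \<preceq> \<beta>}) = {\<epsilon>. \<epsilon> \<preceq> \<alpha> + \<beta>}"
      using refines_add refines_add_split[of _ \<alpha> \<beta>] by (fastforce simp: image_iff)
  qed
  show ?thesis
    unfolding refinement_sum_def
    by (simp add: sum.reindex_bij_betw[OF bij, symmetric] sum_product scale_mult
        sum.cartesian_product case_prod_unfold H_add power_add)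
qed


section \<open>Signed sums of fixed bidegree\<close>

text \<open>Signed refinement sums of single entries are the cases \<open>d \<le> 1\<close>. The value at
  \<open>(0, 0)\<close> is \<open>1\<close>, in accordance with \<open>H\<^sub>0 = 1\<close>, which single entries do not
  provide. The sum of all \<open>bideg_sum d n\<close> is the formal inverse of \<open>1\<close> plus the sum of all
  generators.\<close>

definition bideg_sum :: "nat \<Rightarrow> nat \<Rightarrow> sNSym" where
  "bideg_sum d n = (\<Sum>\<beta> | df \<beta> = d \<and> weight \<beta> = n. scale ((-1) ^ len \<beta>) (H \<beta>))"

lemma refinement_sum_gen:
  assumes "admissible e"
  shows "refinement_sum (gen e) = bideg_sum (df (gen e)) (val e)"
proof -
  have "{\<beta>. \<beta> \<preceq> gen e} = {\<beta>. df \<beta> = df (gen e) \<and> weight \<beta> = val e}"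
    using assms by (cases e) (auto simp: refines_gen_iff df_gen)
  then show ?thesis by (simp add: refinement_sum_def bideg_sum_def)
qed

lemma bideg_sum_0_0: "bideg_sum 0 0 = 1"
proof -
  have "{\<beta>. df \<beta> = 0 \<and> weight \<beta> = 0} = {0}"
    using size_dc_eq_0_iff by (auto simp: size_dc_eq)
  then show ?thesis by (simp add: bideg_sum_def H_conv_single)
qed

lemma finite_bideg: "finite {\<beta>. df \<beta> = d \<and> weight \<beta> = n}"
  by (rule finite_subset[OF _ finite_size_dc[of "d + n"]]) (auto simp: size_dc_eq)

text \<open>The possible first (or last) entries of a nonempty composition of bidegree \<open>(d, n)\<close>.\<close>

definition entries_upto :: "nat \<Rightarrow> nat \<Rightarrow> entry set" where
  "entries_upto d n = {e. admissible e \<and> df (gen e) \<le> d \<and> val e \<le> n}"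

lemma entries_upto_0: "entries_upto 0 n = Undotted ` {1..n}"
proof -
  have "e \<in> entries_upto 0 n \<longleftrightarrow> e \<in> Undotted ` {1..n}" for e
    by (cases e) (auto simp: entries_upto_def df_gen)
  then show ?thesis by blast
qed

lemma entries_upto_1: "entries_upto 1 n = Undotted ` {1..n} \<union> Dotted ` {..n}"
proof -
  have "e \<in> entries_upto 1 n \<longleftrightarrow> e \<in> Undotted ` {1..n} \<union> Dotted ` {..n}" for e
    by (cases e) (auto simp: entries_upto_def df_gen)
  then show ?thesis by blast
qed

lemma finite_entries_upto: "finite (entries_upto d n)"
proof -
  have "e \<in> Undotted ` {..n} \<union> Dotted ` {..n}" if "e \<in> entries_upto d n" for e
    using that by (cases e) (auto simp: entries_upto_def)
  then show ?thesis by (meson finite_UnI finite_atMost finite_imageI finite_subset subsetI)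
qed

lemma sum_by_first_entry:
  assumes "(d, n) \<noteq> (0, 0)"
  shows "(\<Sum>\<beta> | df \<beta> = d \<and> weight \<beta> = n. f \<beta>) =
    (\<Sum>e\<in>entries_upto d n. \<Sum>\<gamma> | df \<gamma> = d - df (gen e) \<and> weight \<gamma> = n - val e. f (gen e + \<gamma>))"
    (is "sum f ?B = (\<Sum>e\<in>?E. \<Sum>\<gamma>\<in>?C e. _)")
proof -
  have bij: "bij_betw (\<lambda>(e, \<gamma>). gen e + \<gamma>) (Sigma ?E ?C) ?B"
    unfolding bij_betw_def
  proof
    show "inj_on (\<lambda>(e, \<gamma>). gen e + \<gamma>) (Sigma ?E ?C)"
      by (auto simp: inj_on_def gen_add_inject entries_upto_def)
    show "(\<lambda>(e, \<gamma>). gen e + \<gamma>) ` Sigma ?E ?C = ?B"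
    proof (intro equalityI subsetI)
      fix \<beta> assume "\<beta> \<in> ?B"
      then show "\<beta> \<in> (\<lambda>(e, \<gamma>). gen e + \<gamma>) ` Sigma ?E ?C"
      proof (cases \<beta> rule: dcomp_cases)
        case (2 e \<gamma>)
        then have "(e, \<gamma>) \<in> Sigma ?E ?C"
          using \<open>\<beta> \<in> ?B\<close> by (auto simp: entries_upto_def weight_gen)
        with 2 show ?thesis by force
      qed (use assms in auto)
    qed (auto simp: entries_upto_def weight_gen)
  qed
  show ?thesis
    by (simp add: sum.reindex_bij_betw[OF bij, symmetric] sum.Sigma finite_entries_upto finite_bideg
        case_prod_unfold)
qed

lemma sum_rev_dcomp:
  "(\<Sum>\<beta> | df \<beta> = d \<and> weight \<beta> = n. f (rev_dcomp \<beta>)) = (\<Sum>\<beta> | df \<beta> = d \<and> weight \<beta> = n. f \<beta>)"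
  by (rule sum.reindex_bij_witness[of _ rev_dcomp rev_dcomp])
     (auto simp: rev_dcomp_simps rev_dcomp_invariants)

text \<open>Reversal preserves the bidegree and exchanges first and last entries.\<close>

lemma sum_by_last_entry:
  assumes "(d, n) \<noteq> (0, 0)"
  shows "(\<Sum>\<beta> | df \<beta> = d \<and> weight \<beta> = n. f \<beta>) =
    (\<Sum>e\<in>entries_upto d n. \<Sum>\<gamma> | df \<gamma> = d - df (gen e) \<and> weight \<gamma> = n - val e. f (\<gamma> + gen e))"
proof -
  have "(\<Sum>\<beta> | df \<beta> = d \<and> weight \<beta> = n. f \<beta>) =
      (\<Sum>e\<in>entries_upto d n. \<Sum>\<gamma> | df \<gamma> = d - df (gen e) \<and> weight \<gamma> = n - val e.
        f (rev_dcomp \<gamma> + gen e))"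
    by (subst sum_rev_dcomp[symmetric], subst sum_by_first_entry[OF assms], intro sum.cong refl)
       (auto simp: rev_dcomp_simps rev_dcomp_gen entries_upto_def)
  then show ?thesis
    by (simp add: sum_rev_dcomp[where f = "\<lambda>\<gamma>. f (\<gamma> + gen _)"])
qed

text \<open>The minus sign is the contribution of the removed entry to the length.\<close>

lemma
  assumes "(d, n) \<noteq> (0, 0)"
  shows bideg_sum_first: "bideg_sum d n =
      - (\<Sum>e\<in>entries_upto d n. H (gen e) * bideg_sum (d - df (gen e)) (n - val e))"
    and bideg_sum_last: "bideg_sum d n =
      - (\<Sum>e\<in>entries_upto d n. bideg_sum (d - df (gen e)) (n - val e) * H (gen e))"
proof -
  show "bideg_sum d n =
      - (\<Sum>e\<in>entries_upto d n. H (gen e) * bideg_sum (d - df (gen e)) (n - val e))"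
    unfolding bideg_sum_def sum_by_first_entry[OF assms] sum_negf[symmetric]
    by (intro sum.cong refl)
       (auto simp: entries_upto_def sum_distrib_left len_gen scale_mult_right H_add sum_negf)
  show "bideg_sum d n =
      - (\<Sum>e\<in>entries_upto d n. bideg_sum (d - df (gen e)) (n - val e) * H (gen e))"
    unfolding bideg_sum_def sum_by_last_entry[OF assms] sum_negf[symmetric]
    by (intro sum.cong refl)
       (auto simp: entries_upto_def sum_distrib_right len_gen scale_mult_left H_add sum_negf)
qed

lemma Hn_conv_H: "0 < n \<Longrightarrow> Hn n = H (gen (Undotted n))"
  by (simp add: Hn_def H_conv_single gen_def)

lemma Hn_0: "Hn 0 = 1"
  by (simp add: Hn_def)

lemma Hdot_conv_H: "Hdot n = H (gen (Dotted n))"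
  by (simp add: Hdot_def H_conv_single gen_def)

lemma sum_atMost_split_0: "(\<Sum>k\<le>n. f k) = f 0 + (\<Sum>k=1..n. f k)" for n :: nat
  by (simp add: sum.atMost_shift sum.atLeast1_atMost_eq lessThan_Suc_atMost)

lemma sum_entries_upto_0: "(\<Sum>e\<in>entries_upto 0 n. f e) = (\<Sum>k=1..n. f (Undotted k))"
  by (simp add: entries_upto_0 sum.reindex inj_on_def)

lemma sum_entries_upto_1:
  "(\<Sum>e\<in>entries_upto 1 n. f e) = (\<Sum>k=1..n. f (Undotted k)) + (\<Sum>k\<le>n. f (Dotted k))"
  unfolding entries_upto_1
  by (subst sum.union_disjoint) (auto simp: sum.reindex inj_on_def)

text \<open>The recursions by first and by last entry, with the left-hand side \<open>bideg_sum\<close> absorbed as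
  the summand for \<open>k = 0\<close>.\<close>

lemma bideg_sum_0_inverse:
  assumes "0 < n"
  shows "(\<Sum>k\<le>n. Hn k * bideg_sum 0 (n - k)) = 0" "(\<Sum>k\<le>n. bideg_sum 0 (n - k) * Hn k) = 0"
  using bideg_sum_first[of 0 n] bideg_sum_last[of 0 n] assms
  by (simp_all add: sum_atMost_split_0[of _ n] Hn_0 sum_entries_upto_0 Hn_conv_H df_gen)

lemma bideg_sum_1_inverse:
  shows "(\<Sum>k\<le>n. Hn k * bideg_sum 1 (n - k)) + (\<Sum>k\<le>n. Hdot k * bideg_sum 0 (n - k)) = 0"
    and "(\<Sum>k\<le>n. bideg_sum 1 (n - k) * Hn k) + (\<Sum>k\<le>n. bideg_sum 0 (n - k) * Hdot k) = 0"
proof -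
  note split = sum_atMost_split_0[of "\<lambda>k. Hn k * _ k"] sum_atMost_split_0[of "\<lambda>k. _ k * Hn k"]
  show "(\<Sum>k\<le>n. Hn k * bideg_sum 1 (n - k)) + (\<Sum>k\<le>n. Hdot k * bideg_sum 0 (n - k)) = 0"
    using bideg_sum_first[of 1 n]
    by (simp add: split Hn_0 sum_entries_upto_1[unfolded One_nat_def] Hn_conv_H Hdot_conv_H df_gen)
  show "(\<Sum>k\<le>n. bideg_sum 1 (n - k) * Hn k) + (\<Sum>k\<le>n. bideg_sum 0 (n - k) * Hdot k) = 0"
    using bideg_sum_last[of 1 n]
    by (simp add: split Hn_0 sum_entries_upto_1[unfolded One_nat_def] Hn_conv_H Hdot_conv_H df_gen)
qed


section \<open>Linear maps on the tensor square\<close>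

lemma linear_tensor_left: "Vector_Spaces.linear scale scale (\<lambda>f. f \<otimes> g)"
  unfolding tensor_def by (rule linear_lin_ext)

lemma linear_tensor_right: "Vector_Spaces.linear scale scale (\<lambda>g. f \<otimes> g)"
  unfolding tensor_def lin_ext_def[of _ f]
  by unfold_locales
     (simp_all add: lin_ext_add lin_ext_scale pm.scale_right_distrib
        sum.distrib pm.scale_sum_right mult.commute)

text \<open>Composed with \<open>coprod\<close> this is the convolution product of \<open>F\<close> and \<open>G\<close>. Keeping
  the element of the tensor square as an argument allows reasoning about one factor of a product
  \<open>t \<odot> u\<close> at a time.\<close>

definition conv :: "(sNSym \<Rightarrow> sNSym) \<Rightarrow> (sNSym \<Rightarrow> sNSym) \<Rightarrow> sNSym2 \<Rightarrow> sNSym" where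
  "conv F G t = mult_map (tmap F G t)"

lemma linear_conv: "Vector_Spaces.linear scale scale (conv F G)"
  unfolding conv_def mult_map_def tmap_def by (rule linear_comp[OF linear_lin_ext linear_lin_ext])

lemma mult_map_tensor: "mult_map (f \<otimes> g) = f * g"
proof -
  have lin: "Vector_Spaces.linear scale scale mult_map"
    unfolding mult_map_def by (rule linear_lin_ext)
  have "mult_map (Poly_Mapping.single a 1 \<otimes> g) = Poly_Mapping.single a 1 * g" for a
    by (rule linear_eq_on_basis[OF linear_comp[OF lin linear_tensor_right] linear_mult_right])
       (simp add: tensor_H mult_map_def flip: H_conv_single)
  then show ?thesis
    by (rule linear_eq_on_basis[OF linear_comp[OF lin linear_tensor_left] linear_mult_left])
qed

lemma conv_single: "conv F G (Poly_Mapping.single (\<alpha>, \<beta>) 1) = F (H \<alpha>) * G (H \<beta>)"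
  by (simp add: conv_def tmap_def mult_map_tensor)

lemma conv_tensor_H: "conv F G (H \<alpha> \<otimes> H \<beta>) = F (H \<alpha>) * G (H \<beta>)"
  by (simp add: tensor_H conv_single)

text \<open>Homogeneity and degree bounds for elements of the tensor square are both expressed as membership
  in the span of suitable basis elements.\<close>

abbreviation span2 :: "(dcomp \<times> dcomp) set \<Rightarrow> sNSym2 set" where
  "span2 P \<equiv> pm.span ((\<lambda>p. Poly_Mapping.single p 1) ` P)"

lemma tensor_in_span2: "(\<alpha>, \<beta>) \<in> P \<Longrightarrow> H \<alpha> \<otimes> H \<beta> \<in> span2 P"
  unfolding tensor_H by (rule pm.span_base) blast

lemma linear_eq_on_span2:
  assumes F: "Vector_Spaces.linear scale scale F" and G: "Vector_Spaces.linear scale scale G"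
    and t: "t \<in> span2 P"
    and eq: "\<And>\<alpha> \<beta>. (\<alpha>, \<beta>) \<in> P \<Longrightarrow>
      F (Poly_Mapping.single (\<alpha>, \<beta>) 1) = G (Poly_Mapping.single (\<alpha>, \<beta>) 1)"
  shows "F t = G t"
proof -
  interpret F: Vector_Spaces.linear scale scale F by fact
  interpret G: Vector_Spaces.linear scale scale G by fact
  show ?thesis
    using t
  proof (induction rule: pm.span_induct)
    case base
    show ?case
      by (auto simp: pm.subspace_def F.zero G.zero F.add G.add F.scale G.scale)
  next
    case (step x)
    then show ?case using eq by auto
  qed
qed

lemma tmult_in_span2:
  assumes t: "t \<in> span2 P" and u: "u \<in> span2 Q"
    and R: "\<And>\<alpha> \<beta> \<gamma> \<delta>. (\<alpha>, \<beta>) \<in> P \<Longrightarrow> (\<gamma>, \<delta>) \<in> Q \<Longrightarrow> (\<alpha> + \<gamma>, \<beta> + \<delta>) \<in> R"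
  shows "t \<odot> u \<in> span2 R"
proof -
  interpret L: Vector_Spaces.linear scale scale "\<lambda>t. t \<odot> w" for w
    by (rule linear_tmult_left)
  interpret R: Vector_Spaces.linear scale scale "\<lambda>t. w \<odot> t" for w
    by (rule linear_tmult_right)
  have 1: "Poly_Mapping.single p 1 \<odot> u \<in> span2 R" if p: "p \<in> P" for p
    using u
  proof (induction rule: pm.span_induct)
    case base
    show ?case
      by (auto simp: pm.subspace_def R.zero R.add R.scale intro: pm.span_zero pm.span_add pm.span_scale)
  next
    case (step x)
    then obtain q where "q \<in> Q" "x = Poly_Mapping.single q 1" by blast
    with R[of "fst p" "snd p" "fst q" "snd q"] p show ?case
      by (cases p; cases q) (auto simp: tmult_single intro!: pm.span_scale intro: pm.span_base)
  qed
  show ?thesis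
    using t
  proof (induction rule: pm.span_induct)
    case base
    show ?case
      by (auto simp: pm.subspace_def L.zero L.add L.scale intro: pm.span_zero pm.span_add pm.span_scale)
  next
    case (step x)
    then show ?case using 1 by blast
  qed
qed


section \<open>Homogeneity and triangularity of the coproduct\<close>

text \<open>The index of \<open>Hn n\<close>, covering the convention \<open>H\<^sub>0 = 1\<close>.\<close>

definition hn :: "nat \<Rightarrow> dcomp" where
  "hn n = (if n = 0 then 0 else gen (Undotted n))"

lemma H_zero: "H 0 = 1"
  by (simp add: H_conv_single)

lemma Hn_conv_hn: "Hn n = H (hn n)"
  by (simp add: hn_def Hn_conv_H H_zero Hn_0)

lemma hn_invariants [simp]: "df (hn n) = 0" "weight (hn n) = n"
  by (auto simp: hn_def df_gen weight_gen)

lemma coprod_gen_homogeneous: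
  assumes "admissible e"
  shows "coprod_gen e \<in> span2 {(\<alpha>, \<beta>). df \<alpha> + df \<beta> = df (gen e)}"
  using assms
  by (cases e) (auto simp: Hn_conv_hn Hdot_conv_H df_gen intro!: pm.span_sum pm.span_add tensor_in_span2)

lemma coprod_gen_triangular:
  assumes "admissible e"
  shows "coprod_gen e - H (gen e) \<otimes> H 0 \<in> span2 {(\<alpha>, \<beta>). size_dc \<alpha> < size_dc (gen e)}"
proof (cases e)
  case (Undotted n)
  then have "coprod_gen e - H (gen e) \<otimes> H 0 = (\<Sum>k<n. H (hn k) \<otimes> H (hn (n - k)))"
    using assms by (simp add: Hn_conv_hn hn_def flip: lessThan_Suc_atMost)
  then show ?thesis
    using Undotted assms
    by (auto simp: size_dc_eq df_gen weight_gen intro!: pm.span_sum tensor_in_span2)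
next
  case (Dotted n)
  then have "coprod_gen e - H (gen e) \<otimes> H 0 =
      (\<Sum>k<n. H (gen (Dotted k)) \<otimes> H (hn (n - k))) + (\<Sum>k\<le>n. H (hn (n - k)) \<otimes> H (gen (Dotted k)))"
    using assms
    by (simp add: sum.distrib Hn_conv_hn Hdot_conv_H hn_def flip: lessThan_Suc_atMost)
  then show ?thesis
    using Dotted assms
    by (auto simp: size_dc_eq df_gen weight_gen intro!: pm.span_add pm.span_sum tensor_in_span2)
qed

lemma coprod_H_gen: "admissible e \<Longrightarrow> coprod (H (gen e)) = coprod_gen e"
  by (simp add: H_conv_single coprod_def entries_gen tmult_tone_right)

lemma coprod_H_gen_add: "admissible e \<Longrightarrow> coprod (H (gen e + \<beta>)) = coprod_gen e \<odot> coprod (H \<beta>)"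
  by (simp add: H_add coprod_mult coprod_H_gen)

lemma coprod_H_zero: "coprod (H 0) = H 0 \<otimes> H 0"
  by (simp add: H_zero coprod_one tone_def)

lemma coprod_homogeneous: "coprod (H \<alpha>) \<in> span2 {(\<beta>, \<gamma>). df \<beta> + df \<gamma> = df \<alpha>}"
proof (induction \<alpha> rule: dcomp_induct)
  case zero
  then show ?case by (simp add: coprod_H_zero tensor_in_span2)
next
  case (add e \<beta>)
  then show ?case
    by (auto simp: coprod_H_gen_add intro: tmult_in_span2 coprod_gen_homogeneous)
qed

text \<open>Products of terms \<open>H \<alpha> \<otimes> 1\<close> are again of this form without a sign, since
  \<open>1\<close> has fermionic degree \<open>0\<close>. Every other term of a product has a smaller left
  factor.\<close>

lemma coprod_triangular: "coprod (H \<alpha>) - H \<alpha> \<otimes> H 0 \<in> span2 {(\<beta>, \<gamma>). size_dc \<beta> < size_dc \<alpha>}"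
proof (induction \<alpha> rule: dcomp_induct)
  case zero
  then show ?case by (simp add: coprod_H_zero pm.span_zero)
next
  case (add e \<beta>)
  interpret L: Vector_Spaces.linear scale scale "\<lambda>t. t \<odot> w" for w
    by (rule linear_tmult_left)
  interpret R: Vector_Spaces.linear scale scale "\<lambda>t. w \<odot> t" for w
    by (rule linear_tmult_right)
  let ?r = "coprod_gen e - H (gen e) \<otimes> H 0" and ?r' = "coprod (H \<beta>) - H \<beta> \<otimes> H 0"
  let ?R = "{(\<gamma>, \<delta>). size_dc \<gamma> < size_dc (gen e + \<beta>)}"
  have "(H (gen e) \<otimes> H 0) \<odot> (H \<beta> \<otimes> H 0) = H (gen e + \<beta>) \<otimes> H 0"
    by (simp add: tensor_H tmult_single)
  then have "coprod (H (gen e + \<beta>)) - H (gen e + \<beta>) \<otimes> H 0 =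
      (H (gen e) \<otimes> H 0) \<odot> ?r' + ?r \<odot> (H \<beta> \<otimes> H 0) + ?r \<odot> ?r'"
    using add.hyps by (simp add: coprod_H_gen_add L.diff R.diff)
  moreover have "(H (gen e) \<otimes> H 0) \<odot> ?r' \<in> span2 ?R"
    by (rule tmult_in_span2[OF tensor_in_span2[of _ _ "{(gen e, 0)}"] add.IH]) (auto simp: size_dc_add)
  moreover have "?r \<odot> (H \<beta> \<otimes> H 0) \<in> span2 ?R"
    by (rule tmult_in_span2[OF coprod_gen_triangular[OF add.hyps] tensor_in_span2[of _ _ "{(\<beta>, 0)}"]])
       (auto simp: size_dc_add)
  moreover have "?r \<odot> ?r' \<in> span2 ?R"
    by (rule tmult_in_span2[OF coprod_gen_triangular[OF add.hyps] add.IH]) (auto simp: size_dc_add)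
  ultimately show ?case by (simp add: pm.span_add)
qed


section \<open>Existence and uniqueness of the antipode\<close>

definition signed_refinements :: "dcomp \<Rightarrow> sNSym" where
  "signed_refinements \<alpha> = scale ((-1) ^ (df \<alpha> choose 2)) (refinement_sum (rev_dcomp \<alpha>))"

definition S0 :: "sNSym \<Rightarrow> sNSym" where
  "S0 = lin_ext signed_refinements"

lemma linear_S0: "Vector_Spaces.linear scale scale S0"
  unfolding S0_def by (rule linear_lin_ext)

lemma S0_H: "S0 (H \<alpha>) = signed_refinements \<alpha>"
  by (simp add: S0_def H_conv_single)

lemma choose_two_add: "(m + n) choose 2 = (m choose 2) + (n choose 2) + m * n"
proof (induction m)
  case (Suc m)
  have "Suc k choose 2 = (k choose 2) + k" for k
    by (simp add: numeral_2_eq_2)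
  then show ?case using Suc by simp
qed simp

text \<open>The factor \<open>(-1) ^ (df \<alpha> choose 2)\<close> is the sign of the permutation that reverses
  \<open>df \<alpha>\<close> odd elements.\<close>

lemma S0_H_mult: "S0 (H \<alpha> * H \<beta>) = scale ((-1) ^ (df \<alpha> * df \<beta>)) (S0 (H \<beta>) * S0 (H \<alpha>))"
  by (simp add: S0_H signed_refinements_def rev_dcomp_simps refinement_sum_add scale_mult
      choose_two_add power_add mult_ac flip: H_add)

lemma S0_H_zero: "S0 (H 0) = 1"
  by (simp add: S0_H signed_refinements_def rev_dcomp_simps(1) refinement_sum_zero binomial_eq_0)

lemma S0_H_gen:
  assumes "admissible e"
  shows "S0 (H (gen e)) = bideg_sum (df (gen e)) (val e)"
  using assms
  by (simp add: S0_H signed_refinements_def rev_dcomp_gen refinement_sum_gen df_gen binomial_eq_0)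

lemma S0_Hn: "S0 (Hn n) = bideg_sum 0 n"
  by (cases "n = 0") (simp_all add: Hn_conv_hn hn_def S0_H_zero bideg_sum_0_0 S0_H_gen df_gen)

lemma S0_Hdot: "S0 (Hdot n) = bideg_sum 1 n"
  by (simp add: Hdot_conv_H S0_H_gen df_gen)

lemma sum_atMost_rev: "(\<Sum>k\<le>n. f k) = (\<Sum>k\<le>n. f (n - k))" for n :: nat
  by (rule sum.reindex_bij_witness[of _ "\<lambda>k. n - k" "\<lambda>k. n - k"]) auto

text \<open>By \<open>S0_Hn\<close> and \<open>S0_Hdot\<close> these are the identities satisfied by
  \<open>bideg_sum\<close>. The coproduct indexes its summands in the opposite order, so some of the
  sums have to be reversed.\<close>

lemma conv_S0_gen:
  assumes "admissible e"
  shows "conv S0 id (coprod_gen e) = 0" "conv id S0 (coprod_gen e) = 0"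
proof -
  interpret C: Vector_Spaces.linear scale scale "conv F G" for F G
    by (rule linear_conv)
  have conv_gens:
    "conv F G (Hn j \<otimes> Hn k) = F (Hn j) * G (Hn k)"
    "conv F G (Hdot j \<otimes> Hn k) = F (Hdot j) * G (Hn k)"
    "conv F G (Hn j \<otimes> Hdot k) = F (Hn j) * G (Hdot k)" for F G j k
    by (simp_all add: Hn_conv_hn Hdot_conv_H conv_tensor_H)
  note simps = C.sum C.add conv_gens S0_Hn S0_Hdot sum.distrib
  show "conv S0 id (coprod_gen e) = 0"
  proof (cases e)
    case (Undotted n)
    then show ?thesis
      using assms bideg_sum_0_inverse(2)[of n] sum_atMost_rev[of "\<lambda>k. bideg_sum 0 k * Hn (n - k)" n]
      by (simp add: simps)
  next
    case (Dotted n)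
    then show ?thesis
      using bideg_sum_1_inverse(2)[of n] sum_atMost_rev[of "\<lambda>k. bideg_sum 1 k * Hn (n - k)" n]
      by (simp add: simps)
  qed
  show "conv id S0 (coprod_gen e) = 0"
  proof (cases e)
    case (Undotted n)
    then show ?thesis
      using assms bideg_sum_0_inverse(1)[of n] by (simp add: simps)
  next
    case (Dotted n)
    then show ?thesis
      using bideg_sum_1_inverse(1)[of n] sum_atMost_rev[of "\<lambda>k. Hn (n - k) * bideg_sum 1 k" n]
      by (simp add: simps add.commute)
  qed
qed

text \<open>For \<open>t = H \<alpha> \<otimes> H \<beta>\<close>, the element \<open>H \<gamma>\<close> moves past \<open>H \<beta>\<close> in the
  tensor square and past \<open>H \<alpha>\<close> under \<open>S0\<close>. The total sign depends only on
  \<open>df \<alpha> + df \<beta>\<close>, so \<open>conv S0 id t\<close> can be factored out for every homogeneous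
  \<open>t\<close>.\<close>

lemma conv_S0_tmult_single:
  assumes "t \<in> span2 {(\<alpha>, \<beta>). df \<alpha> + df \<beta> = d}"
  shows "conv S0 id (t \<odot> Poly_Mapping.single (\<gamma>, \<delta>) 1) =
    scale ((-1) ^ (d * df \<gamma>)) (S0 (H \<gamma>) * conv S0 id t * H \<delta>)"
proof (rule linear_eq_on_span2[OF linear_comp[OF linear_conv linear_tmult_left] _ assms])
  show "Vector_Spaces.linear scale scale
      (\<lambda>t. scale ((-1) ^ (d * df \<gamma>)) (S0 (H \<gamma>) * conv S0 id t * H \<delta>))"
    by (intro linear_comp[OF pm.linear_scale_self] linear_comp[OF linear_mult_left]
        linear_comp[OF linear_mult_right] linear_conv)
  fix \<alpha> \<beta> assume "(\<alpha>, \<beta>) \<in> {(\<alpha>, \<beta>). df \<alpha> + df \<beta> = d}"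
  then have sign: "(-1) ^ (df \<beta> * df \<gamma>) * (-1) ^ (df \<alpha> * df \<gamma>) = ((-1) ^ (d * df \<gamma>) :: rat)"
    by (simp add: add.commute flip: power_add add_mult_distrib)
  interpret C: Vector_Spaces.linear scale scale "conv S0 id" by (rule linear_conv)
  show "conv S0 id (Poly_Mapping.single (\<alpha>, \<beta>) 1 \<odot> Poly_Mapping.single (\<gamma>, \<delta>) 1) =
      scale ((-1) ^ (d * df \<gamma>)) (S0 (H \<gamma>) * conv S0 id (Poly_Mapping.single (\<alpha>, \<beta>) 1) * H \<delta>)"
    by (simp add: tmult_single C.scale conv_single S0_H_mult H_add scale_mult_left mult.assoc
        flip: sign)
qed

lemma conv_S0_single_tmult:
  assumes "u \<in> span2 {(\<gamma>, \<delta>). df \<gamma> + df \<delta> = d}"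
  shows "conv id S0 (Poly_Mapping.single (\<alpha>, \<beta>) 1 \<odot> u) =
    scale ((-1) ^ (df \<beta> * d)) (H \<alpha> * conv id S0 u * S0 (H \<beta>))"
proof (rule linear_eq_on_span2[OF linear_comp[OF linear_conv linear_tmult_right] _ assms])
  show "Vector_Spaces.linear scale scale
      (\<lambda>u. scale ((-1) ^ (df \<beta> * d)) (H \<alpha> * conv id S0 u * S0 (H \<beta>)))"
    by (intro linear_comp[OF pm.linear_scale_self] linear_comp[OF linear_mult_left]
        linear_comp[OF linear_mult_right] linear_conv)
  fix \<gamma> \<delta> assume "(\<gamma>, \<delta>) \<in> {(\<gamma>, \<delta>). df \<gamma> + df \<delta> = d}"
  then have d: "d = df \<gamma> + df \<delta>" by simp
  interpret C: Vector_Spaces.linear scale scale "conv id S0" by (rule linear_conv)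
  show "conv id S0 (Poly_Mapping.single (\<alpha>, \<beta>) 1 \<odot> Poly_Mapping.single (\<gamma>, \<delta>) 1) =
      scale ((-1) ^ (df \<beta> * d)) (H \<alpha> * conv id S0 (Poly_Mapping.single (\<gamma>, \<delta>) 1) * S0 (H \<beta>))"
    by (simp add: d tmult_single C.scale conv_single S0_H_mult H_add scale_mult_right mult.assoc
        add_mult_distrib2 power_add)
qed

lemma linear_zero: "Vector_Spaces.linear scale scale (\<lambda>_. 0)"
  by unfold_locales simp_all

lemma conv_S0_tmult_zero:
  assumes "t \<in> span2 {(\<alpha>, \<beta>). df \<alpha> + df \<beta> = d}" "conv S0 id t = 0"
  shows "conv S0 id (t \<odot> u) = 0"
proof (rule linear_eq_on_basis[OF linear_comp[OF linear_conv linear_tmult_right] linear_zero])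
  fix p :: "dcomp \<times> dcomp"
  show "conv S0 id (t \<odot> Poly_Mapping.single p 1) = 0"
    by (cases p) (simp add: conv_S0_tmult_single[OF assms(1)] assms(2))
qed

lemma conv_tmult_S0_zero:
  assumes "u \<in> span2 {(\<gamma>, \<delta>). df \<gamma> + df \<delta> = d}" "conv id S0 u = 0"
  shows "conv id S0 (t \<odot> u) = 0"
proof (rule linear_eq_on_basis[OF linear_comp[OF linear_conv linear_tmult_left] linear_zero])
  fix p :: "dcomp \<times> dcomp"
  show "conv id S0 (Poly_Mapping.single p 1 \<odot> u) = 0"
    by (cases p) (simp add: conv_S0_single_tmult[OF assms(1)] assms(2))
qed

lemma conv_S0_coprod: "\<alpha> \<noteq> 0 \<Longrightarrow> conv S0 id (coprod (H \<alpha>)) = 0"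
  by (cases \<alpha> rule: dcomp_cases)
     (auto simp: coprod_H_gen_add intro: conv_S0_tmult_zero coprod_gen_homogeneous conv_S0_gen)

text \<open>Here the right tensor factor has to be killed, so the generator that is used is the last one;
  it is reached by induction.\<close>

lemma conv_coprod_S0: "\<alpha> \<noteq> 0 \<Longrightarrow> conv id S0 (coprod (H \<alpha>)) = 0"
proof (induction \<alpha> rule: dcomp_induct)
  case (add e \<beta>)
  show ?case
  proof (cases "\<beta> = 0")
    case True
    then show ?thesis
      by (simp only: add_0_right coprod_H_gen[OF add.hyps] conv_S0_gen(2)[OF add.hyps])
  next
    case False
    then show ?thesis
      unfolding coprod_H_gen_add[OF add.hyps]
      by (intro conv_tmult_S0_zero[OF coprod_homogeneous] add.IH)
  qed
qed simp

lemma counit_H: "counit (H \<alpha>) = (if \<alpha> = 0 then 1 else 0)"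
  by (simp add: counit_def H_conv_single lookup_single)

lemma linear_unit_counit: "Vector_Spaces.linear scale scale (\<lambda>f. unit_map (counit f))"
  unfolding unit_map_def counit_def
  by unfold_locales (simp_all add: lookup_add pm.scale_left_distrib)

text \<open>By linearity the antipode axioms need only be tested on the basis.\<close>

lemma is_antipode_iff:
  "is_antipode S \<longleftrightarrow> Vector_Spaces.linear scale scale S \<and>
     (\<forall>\<alpha>. conv S id (coprod (H \<alpha>)) = (if \<alpha> = 0 then 1 else 0)) \<and>
     (\<forall>\<alpha>. conv id S (coprod (H \<alpha>)) = (if \<alpha> = 0 then 1 else 0))"
proof -
  have "mult_map \<circ> tmap F G \<circ> coprod = unit_map \<circ> counit \<longleftrightarrow>
      (\<forall>\<alpha>. conv F G (coprod (H \<alpha>)) = (if \<alpha> = 0 then 1 else 0))" (is "?L \<longleftrightarrow> ?R") for F G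
  proof
    assume ?L
    then have "conv F G (coprod f) = unit_map (counit f)" for f
      unfolding conv_def by (metis comp_apply)
    then show ?R by (simp add: counit_H unit_map_def)
  next
    assume R: ?R
    have "conv F G (coprod f) = unit_map (counit f)" for f
      by (rule linear_eq_on_basis[OF linear_comp[OF linear_conv linear_coprod] linear_unit_counit])
         (use R in \<open>auto simp: counit_H unit_map_def simp flip: H_conv_single\<close>)
    then show ?L by (auto simp: conv_def)
  qed
  then show ?thesis unfolding is_antipode_def by blast
qed

lemma is_antipode_S0: "is_antipode S0"
  unfolding is_antipode_iff
proof (intro conjI allI linear_S0)
  have "conv F G (coprod (H 0)) = F (H 0) * G (H 0)" for F G
    by (simp only: coprod_H_zero conv_tensor_H)
  then have "conv S0 id (coprod (H 0)) = 1" "conv id S0 (coprod (H 0)) = 1"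
    by (simp_all only: S0_H_zero id_apply) (simp_all only: H_zero mult_1_left mult_1_right)
  then show "conv S0 id (coprod (H \<alpha>)) = (if \<alpha> = 0 then 1 else 0)"
    "conv id S0 (coprod (H \<alpha>)) = (if \<alpha> = 0 then 1 else 0)" for \<alpha>
    by (cases "\<alpha> = 0"; simp_all only: conv_S0_coprod conv_coprod_S0 if_True if_False not_False_eq_True)+
qed

text \<open>Two antipodes agree on the left tensor factors of the lower terms in \<open>coprod_triangular\<close>
  by induction on the degree, hence on the leading term.\<close>

lemma antipode_unique:
  assumes "is_antipode S" "is_antipode S'"
  shows "S = S'"
proof
  fix f
  have lin: "Vector_Spaces.linear scale scale S" "Vector_Spaces.linear scale scale S'"
    using assms by (auto simp: is_antipode_iff)
  interpret C: Vector_Spaces.linear scale scale "conv F id" for F by (rule linear_conv)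
  have "S (H \<alpha>) = S' (H \<alpha>)" for \<alpha>
  proof (induction "size_dc \<alpha>" arbitrary: \<alpha> rule: less_induct)
    case less
    let ?r = "coprod (H \<alpha>) - H \<alpha> \<otimes> H 0"
    have split: "conv F id (coprod (H \<alpha>)) = F (H \<alpha>) + conv F id ?r" for F
      by (simp only: C.diff conv_tensor_H) (simp add: H_zero)
    have "conv S id ?r = conv S' id ?r"
      by (rule linear_eq_on_span2[OF linear_conv linear_conv coprod_triangular])
         (auto simp: conv_single less)
    moreover have "conv S id (coprod (H \<alpha>)) = conv S' id (coprod (H \<alpha>))"
      using assms by (simp add: is_antipode_iff)
    ultimately show ?case by (simp add: split)
  qed
  then show "S f = S' f"
    by (rule linear_eq_on_basis[OF lin, unfolded H_conv_single[symmetric]])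
qed

theorem proposition4p5:
  fixes \<alpha> :: dcomp
  shows "antipode (H \<alpha>) =
    scale ((-1) ^ (df \<alpha> choose 2))
      (\<Sum>\<beta> | \<beta> \<preceq> rev_dcomp \<alpha>. scale ((-1) ^ len \<beta>) (H \<beta>))"
proof -
  have "antipode = S0"
    unfolding antipode_def
    by (rule the_equality, rule is_antipode_S0) (rule antipode_unique[OF _ is_antipode_S0])
  then show ?thesis
    by (simp add: S0_H signed_refinements_def refinement_sum_def)
qed

end
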